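(* For any $\mathcal{L}(\rhd)$-formula $A$, the following are equivalent: 1. $\mathbf{IL}^-(\mathbf{P}) \vdash A$. 2. $A$ is valid in all simplified $\mathbf{IL}^-(\mathbf{P})$-frames. 3. $A$ is valid in all finite simplified $\mathbf{IL}^-(\mathbf{P})$-frames $(W,R,S)$ for which there exist no $x, y, z \in W$ such that $x S y$ and $y S z$.
   Context: The language $\mathcal{L}(\rhd)$ has countably many propositional variables, the constant $\bot$, connectives $\neg, \land, \lor, \to$, a unary modal operator $\Box$ and a binary modal operator $\rhd$. The logic $\mathbf{IL}^-(\mathbf{P})$ has as axioms: all tautologies in $\mathcal{L}(\rhd)$; $\Box(A \to B) \to (\Box A \to \Box B)$; $\Box(\Box A \to A) \to \Box A$; $\mathbf{J3}$: $(A \rhd C) \land (B \rhd C) \to (A \lor B) \rhd C$; $\mathbf{J6}$: $\Box A \leftrightarrow (\neg A) \rhd \bot$; and the persistence principle $\mathbf{P}$: $A \rhd B \to \Box(A \rhd B)$ (all as schemes). Its inference rules are Modus Ponens, Necessitation ($A / \Box A$), $\mathbf{R1}$: from $A \to B$ infer $C \rhd A \to C \rhd B$, and $\mathbf{R2}$: from $A \to B$ infer $B \rhd C \to A \rhd C$. A simplified $\mathbf{IL}^-(\mathbf{P})$-frame is a triple $(W, R, S)$ where $W$ is a non-empty set, $R$ is a transitive and conversely well-founded binary relation on $W$, and $S$ is an arbitrary binary relation on $W$. A simplified $\mathbf{IL}^-(\mathbf{P})$-model is a quadruple $(W,R,S,\Vdash)$ where $(W,R,S)$ is such a frame and $\Vdash$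 is a relation between $W$ and $\mathcal{L}(\rhd)$-formulas satisfying the usual Boolean clauses, $w \Vdash \Box A \iff (\forall x \in W)(w R x \Rightarrow x \Vdash A)$, and $w \Vdash A \rhd B \iff (\forall x \in W)\bigl(w R x \ \&\ x \Vdash A \Rightarrow (\exists y \in W)(x S y \ \&\ y \Vdash B)\bigr)$. A formula is valid in a frame if it is satisfied at every $w \in W$ in every model based on the frame. *)

theory Defs
  imports Main
begin

datatype fm =
    Var nat
  | Bot  ("\<^bold>\<bottom>")
  | Neg fm  ("\<^bold>\<not> _" [80] 80)
  | And fm fm  (infixr "\<^bold>\<and>" 70)
  | Or fm fm  (infixr "\<^bold>\<or>" 65)
  | Imp fm fm  (infixr "\<^bold>\<longrightarrow>" 55)
  | Box fm  ("\<^bold>\<box> _" [80] 80)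
  | Rhd fm fm  (infix "\<rhd>" 60)

abbreviation Iff :: "fm \<Rightarrow> fm \<Rightarrow> fm"  (infix "\<^bold>\<longleftrightarrow>" 53) where
  "A \<^bold>\<longleftrightarrow> B \<equiv> (A \<^bold>\<longrightarrow> B) \<^bold>\<and> (B \<^bold>\<longrightarrow> A)"

text \<open>Boolean evaluation in which variables and formulas whose outermost connective is modal
  are the atoms. A tautology of the modal language is then a formula true under every assignment
  to these atoms, that is, a substitution instance of a propositional tautology.\<close>

primrec bool_eval :: "(fm \<Rightarrow> bool) \<Rightarrow> fm \<Rightarrow> bool" where
  "bool_eval v (Var p) = v (Var p)"
| "bool_eval v \<^bold>\<bottom> = False"
| "bool_eval v (\<^bold>\<not> A) = (\<not> bool_eval v A)"
| "bool_eval v (A \<^bold>\<and> B) = (bool_eval v A \<and> bool_eval v B)"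
| "bool_eval v (A \<^bold>\<or> B) = (bool_eval v A \<or> bool_eval v B)"
| "bool_eval v (A \<^bold>\<longrightarrow> B) = (bool_eval v A \<longrightarrow> bool_eval v B)"
| "bool_eval v (\<^bold>\<box> A) = v (\<^bold>\<box> A)"
| "bool_eval v (A \<rhd> B) = v (A \<rhd> B)"

definition tautology :: "fm \<Rightarrow> bool" where
  "tautology A \<longleftrightarrow> (\<forall>v. bool_eval v A)"

inductive ILminusP :: "fm \<Rightarrow> bool"  ("\<turnstile> _" [50] 50) where
  Taut: "tautology A \<Longrightarrow> \<turnstile> A"
| K: "\<turnstile> \<^bold>\<box> (A \<^bold>\<longrightarrow> B) \<^bold>\<longrightarrow> (\<^bold>\<box> A \<^bold>\<longrightarrow> \<^bold>\<box> B)"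
| Loeb: "\<turnstile> \<^bold>\<box> (\<^bold>\<box> A \<^bold>\<longrightarrow> A) \<^bold>\<longrightarrow> \<^bold>\<box> A"
| J3: "\<turnstile> (A \<rhd> C) \<^bold>\<and> (B \<rhd> C) \<^bold>\<longrightarrow> ((A \<^bold>\<or> B) \<rhd> C)"
| J6: "\<turnstile> \<^bold>\<box> A \<^bold>\<longleftrightarrow> ((\<^bold>\<not> A) \<rhd> \<^bold>\<bottom>)"
| P: "\<turnstile> (A \<rhd> B) \<^bold>\<longrightarrow> \<^bold>\<box> (A \<rhd> B)"
| MP: "\<turnstile> A \<^bold>\<longrightarrow> B \<Longrightarrow> \<turnstile> A \<Longrightarrow> \<turnstile> B"
| Nec: "\<turnstile> A \<Longrightarrow> \<turnstile> \<^bold>\<box> A"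
| R1: "\<turnstile> A \<^bold>\<longrightarrow> B \<Longrightarrow> \<turnstile> (C \<rhd> A) \<^bold>\<longrightarrow> (C \<rhd> B)"
| R2: "\<turnstile> A \<^bold>\<longrightarrow> B \<Longrightarrow> \<turnstile> (B \<rhd> C) \<^bold>\<longrightarrow> (A \<rhd> C)"

locale simplified_frame =
  fixes W :: "'w set" and R S :: "'w rel"
  assumes nonempty: "W \<noteq> {}"
    and R_on: "R \<subseteq> W \<times> W"
    and S_on: "S \<subseteq> W \<times> W"
    and R_trans: "trans R"
    and R_conv_wf: "wf (R\<inverse>)"

text \<open>The forcing relation is part of the model; its values outside \<open>W\<close> are unconstrained and
  irrelevant.\<close>

locale simplified_model = simplified_frame W R S
  for W :: "'w set" and R S :: "'w rel" +
  fixes forces :: "'w \<Rightarrow> fm \<Rightarrow> bool"  (infix "\<tturnstile>" 50)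
  assumes forces_Bot: "w \<in> W \<Longrightarrow> \<not> w \<tturnstile> \<^bold>\<bottom>"
    and forces_Neg: "w \<in> W \<Longrightarrow> w \<tturnstile> \<^bold>\<not> A \<longleftrightarrow> \<not> w \<tturnstile> A"
    and forces_And: "w \<in> W \<Longrightarrow> w \<tturnstile> A \<^bold>\<and> B \<longleftrightarrow> w \<tturnstile> A \<and> w \<tturnstile> B"
    and forces_Or: "w \<in> W \<Longrightarrow> w \<tturnstile> A \<^bold>\<or> B \<longleftrightarrow> w \<tturnstile> A \<or> w \<tturnstile> B"
    and forces_Imp: "w \<in> W \<Longrightarrow> w \<tturnstile> A \<^bold>\<longrightarrow> B \<longleftrightarrow> (w \<tturnstile> A \<longrightarrow> w \<tturnstile> B)"
    and forces_Box: "w \<in> W \<Longrightarrow> w \<tturnstile> \<^bold>\<box> A \<longleftrightarrow> (\<forall>x\<in>W. (w, x) \<in> R \<longrightarrow> x \<tturnstile> A)"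
    and forces_Rhd: "w \<in> W \<Longrightarrow> w \<tturnstile> A \<rhd> B \<longleftrightarrow>
      (\<forall>x\<in>W. (w, x) \<in> R \<and> x \<tturnstile> A \<longrightarrow> (\<exists>y\<in>W. (x, y) \<in> S \<and> y \<tturnstile> B))"

definition valid_in :: "'w set \<Rightarrow> 'w rel \<Rightarrow> 'w rel \<Rightarrow> fm \<Rightarrow> bool" where
  "valid_in W R S A \<longleftrightarrow>
    (\<forall>forces. simplified_model W R S forces \<longrightarrow> (\<forall>w\<in>W. forces w A))"

text \<open>HOL cannot quantify over types inside a formula, so the following two notions range over
  all frames whose set of worlds is a subset of the given type. If that type is infinite, it
  contains an isomorphic copy of every finite frame.\<close>

definition valid_all_frames :: "'w itself \<Rightarrow> fm \<Rightarrow> bool" where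
  "valid_all_frames _ A \<longleftrightarrow>
    (\<forall>(W :: 'w set) R S. simplified_frame W R S \<longrightarrow> valid_in W R S A)"

definition valid_finite_frames :: "'w itself \<Rightarrow> fm \<Rightarrow> bool" where
  "valid_finite_frames _ A \<longleftrightarrow>
    (\<forall>(W :: 'w set) R S. simplified_frame W R S \<and> finite W \<and>
        \<not> (\<exists>x\<in>W. \<exists>y\<in>W. \<exists>z\<in>W. (x, y) \<in> S \<and> (y, z) \<in> S)
      \<longrightarrow> valid_in W R S A)"

end

theory Submission imports Defs begin

text \<open>
  Soundness is a direct check: \<open>P\<close> holds because \<open>R\<close> is transitive and because the \<open>S\<close>-successors
  that witness \<open>A \<rhd> B\<close> depend on the intermediate world only.

  For completeness, a finite countermodel to an unprovable \<open>A\<close> is built from the complete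
  descriptions (\<^emph>\<open>atoms\<close>) of consistent formulas relative to the subformulas of \<open>A\<close>.  A world is
  a pair of an atom and a tag.  The tag \<open>Some D\<close> promises that the \<open>S\<close>-successors of the world
  never contain \<open>D\<close>; the tag \<open>None\<close> marks worlds that have no \<open>S\<close>-successors and are never
  \<open>R\<close>-successors.  All \<open>S\<close>-arrows lead from \<open>Some\<close>-worlds to \<open>None\<close>-worlds, so
  two of them never compose.

  To refute \<open>C \<rhd> D\<close> at an atom \<open>\<Gamma>\<close>, an \<open>R\<close>-successor with tag \<open>Some D\<close> is needed that
  contains \<open>C\<close>.  Its tag would clash with \<open>E \<rhd> F \<in> \<Gamma>\<close> if it contained \<open>E\<close> and every
  world with \<open>F\<close> had to contain \<open>D\<close>, that is, if \<open>F \<longrightarrow> D\<close> were provable.  So the successor is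
  required to refute every such \<open>E\<close>.  This is consistent: by \<open>R1\<close> all these \<open>E\<close> satisfy \<open>E \<rhd> D\<close>, by \<open>J3\<close> so
  does their disjunction, and if \<open>C\<close> necessarily implied this disjunction, then \<open>C \<rhd> D\<close> would follow
  (lemma \<open>Rhd_by_Box\<close>).  Loeb's axiom makes the successor satisfy \<open>C \<rhd> D\<close>, so that the set of true
  modal formulas grows strictly along \<open>R\<close>, which gives converse well-foundedness (lemma
  \<open>critical_successor\<close>).  By \<open>P\<close>, formulas \<open>E \<rhd> F\<close> are inherited along \<open>R\<close>; this makes the
  requirement on tags compatible with transitivity, although the tag does not record from which
  world its bearer is seen.
\<close>

section \<open>Soundness\<close>

lemma (in simplified_model) forces_bool_eval:
  "w \<in> W \<Longrightarrow> w \<tturnstile> B \<longleftrightarrow> bool_eval (\<lambda>C. w \<tturnstile> C) B"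
  by (induction B) (simp_all add: forces_Bot forces_Neg forces_And forces_Or forces_Imp)

lemma (in simplified_model) soundness: "\<turnstile> B \<Longrightarrow> w \<in> W \<Longrightarrow> w \<tturnstile> B"
proof (induction arbitrary: w rule: ILminusP.induct)
  case (Taut A)
  then show ?case unfolding forces_bool_eval[OF Taut(2), of A] by (simp add: tautology_def)
next
  case (K A B)
  then show ?case by (simp add: forces_Imp forces_Box)
next
  case (Loeb A)
  have "x \<tturnstile> A" if "x \<in> W" "(w, x) \<in> R" and box: "w \<tturnstile> \<^bold>\<box> (\<^bold>\<box> A \<^bold>\<longrightarrow> A)" for x
    using R_conv_wf that(1,2)
  proof (induction x rule: wf_induct_rule)
    case (less x)
    have "y \<tturnstile> A" if "y \<in> W" "(x, y) \<in> R" for y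
      using less.IH[of y] that transD[OF R_trans less.prems(2) that(2)] by simp
    then show ?case
      using box less.prems Loeb by (simp add: forces_Box forces_Imp)
  qed
  then show ?case using Loeb by (simp add: forces_Imp forces_Box)
next
  case (J3 A C B)
  then show ?case by (auto simp: forces_Imp forces_And forces_Or forces_Rhd)
next
  case (J6 A)
  then show ?case
    by (auto simp: forces_Imp forces_And forces_Neg forces_Box forces_Rhd forces_Bot)
next
  case (P A B)
  have "x \<tturnstile> A \<rhd> B" if "w \<tturnstile> A \<rhd> B" "x \<in> W" "(w, x) \<in> R" for x
    using that(1) transD[OF R_trans that(3)] P that(2) by (auto simp: forces_Rhd)
  then show ?case using P by (simp add: forces_Imp forces_Box)
next
  case (MP A B)
  from MP.IH[OF MP.prems] MP.prems show ?case by (simp add: forces_Imp)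
next
  case (Nec A)
  then show ?case by (simp add: forces_Box)
next
  case (R1 A B C)
  then show ?case by (simp add: forces_Imp forces_Rhd) blast
next
  case (R2 A B C)
  then show ?case by (simp add: forces_Imp forces_Rhd)
qed

lemma valid_if_provable: "\<turnstile> A \<Longrightarrow> valid_in W R S A"
  by (simp add: valid_in_def simplified_model.soundness)


section \<open>Derivations in the logic\<close>

text \<open>The logic is closed under tautological consequence; stated semantically, such steps are left
  to the simplifier.\<close>

lemma conseq1:
  assumes "\<turnstile> A" "\<And>v. bool_eval v A \<Longrightarrow> bool_eval v B"
  shows "\<turnstile> B"
  using assms by (intro MP[OF Taut assms(1)]) (simp add: tautology_def)

lemma conseq2:
  assumes "\<turnstile> A" "\<turnstile> B" "\<And>v. bool_eval v A \<Longrightarrow> bool_eval v B \<Longrightarrow> bool_eval v C"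
  shows "\<turnstile> C"
  using assms by (intro MP[OF conseq1[OF assms(1)] assms(2)]) simp

lemma conseq3:
  assumes "\<turnstile> A" "\<turnstile> B" "\<turnstile> C"
    "\<And>v. bool_eval v A \<Longrightarrow> bool_eval v B \<Longrightarrow> bool_eval v C \<Longrightarrow> bool_eval v D"
  shows "\<turnstile> D"
  using assms by (intro MP[OF conseq2[OF assms(1,2)] assms(3)]) simp

lemma imp_trans: "\<turnstile> A \<^bold>\<longrightarrow> B \<Longrightarrow> \<turnstile> B \<^bold>\<longrightarrow> C \<Longrightarrow> \<turnstile> A \<^bold>\<longrightarrow> C"
  by (erule (1) conseq2) simp

lemma Box_mono:
  assumes "\<turnstile> A \<^bold>\<longrightarrow> B"
  shows "\<turnstile> \<^bold>\<box> A \<^bold>\<longrightarrow> \<^bold>\<box> B"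
  using MP[OF K Nec[OF assms]] .

lemma Box_And: "\<turnstile> \<^bold>\<box> A \<^bold>\<and> \<^bold>\<box> B \<^bold>\<longrightarrow> \<^bold>\<box> (A \<^bold>\<and> B)"
proof -
  have "\<turnstile> A \<^bold>\<longrightarrow> (B \<^bold>\<longrightarrow> A \<^bold>\<and> B)"
    by (rule Taut) (simp add: tautology_def)
  from Box_mono[OF this] show ?thesis
    by (rule conseq2[OF _ K[of B "A \<^bold>\<and> B"]]) simp
qed

text \<open>Transitivity of \<open>\<box>\<close> is an instance of \<open>P\<close>, because \<open>J6\<close> turns \<open>\<box> A\<close> into a formula
  of the form \<open>_ \<rhd> _\<close>.\<close>

lemma Box_trans: "\<turnstile> \<^bold>\<box> A \<^bold>\<longrightarrow> \<^bold>\<box> \<^bold>\<box> A"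
proof -
  have "\<turnstile> (\<^bold>\<not> A) \<rhd> \<^bold>\<bottom> \<^bold>\<longrightarrow> \<^bold>\<box> A"
    by (rule conseq1[OF J6[of A]]) simp
  from Box_mono[OF this] show ?thesis
    by (rule conseq3[OF _ J6[of A] P[of "\<^bold>\<not> A" "\<^bold>\<bottom>"]]) simp
qed

lemma Box_Not_imp_Rhd: "\<turnstile> \<^bold>\<box> (\<^bold>\<not> A) \<^bold>\<longrightarrow> A \<rhd> B"
proof -
  have "\<turnstile> (\<^bold>\<not> \<^bold>\<not> A) \<rhd> \<^bold>\<bottom> \<^bold>\<longrightarrow> A \<rhd> \<^bold>\<bottom>"
    by (rule R2, rule Taut) (simp add: tautology_def)
  moreover have "\<turnstile> A \<rhd> \<^bold>\<bottom> \<^bold>\<longrightarrow> A \<rhd> B"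
    by (rule R1, rule Taut) (simp add: tautology_def)
  ultimately show ?thesis
    by (rule conseq3[OF J6[of "\<^bold>\<not> A"]]) simp
qed

text \<open>The part of \<open>C\<close> outside \<open>E\<close> is necessarily empty, so it is related to everything; \<open>J3\<close> adds
  the part inside \<open>E\<close>.\<close>

lemma Rhd_by_Box: "\<turnstile> \<^bold>\<box> (\<^bold>\<not> (C \<^bold>\<and> \<^bold>\<not> E)) \<^bold>\<and> (E \<rhd> D) \<^bold>\<longrightarrow> C \<rhd> D"
proof -
  let ?X = "C \<^bold>\<and> \<^bold>\<not> E"
  have "\<turnstile> (?X \<^bold>\<or> E) \<rhd> D \<^bold>\<longrightarrow> C \<rhd> D"
    by (rule R2, rule Taut) (simp add: tautology_def)
  then show ?thesis
    by (rule conseq3[OF _ Box_Not_imp_Rhd[of ?X D] J3[of ?X D E]]) simp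
qed

lemma Rhd_finite_disjunction:
  assumes "finite Q" "\<And>E. E \<in> Q \<Longrightarrow> \<turnstile> Y \<^bold>\<longrightarrow> E \<rhd> D"
  obtains E where "\<turnstile> Y \<^bold>\<longrightarrow> E \<rhd> D" "\<And>E'. E' \<in> Q \<Longrightarrow> \<turnstile> E' \<^bold>\<longrightarrow> E"
proof -
  have "\<exists>E. \<turnstile> Y \<^bold>\<longrightarrow> E \<rhd> D \<and> (\<forall>E'\<in>Q. \<turnstile> E' \<^bold>\<longrightarrow> E)"
    using assms
  proof (induction Q rule: finite_induct)
    case empty
    have "\<turnstile> \<^bold>\<box> (\<^bold>\<not> \<^bold>\<bottom>)"
      by (rule Nec, rule Taut) (simp add: tautology_def)
    then have "\<turnstile> Y \<^bold>\<longrightarrow> \<^bold>\<bottom> \<rhd> D"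
      by (rule conseq2[OF _ Box_Not_imp_Rhd[of "\<^bold>\<bottom>" D]]) simp
    then show ?case by blast
  next
    case (insert E1 Q)
    then obtain E where E: "\<turnstile> Y \<^bold>\<longrightarrow> E \<rhd> D" "\<forall>E'\<in>Q. \<turnstile> E' \<^bold>\<longrightarrow> E" by auto
    have "\<turnstile> Y \<^bold>\<longrightarrow> E1 \<rhd> D" using insert.prems by simp
    then have "\<turnstile> Y \<^bold>\<longrightarrow> (E1 \<^bold>\<or> E) \<rhd> D"
      by (rule conseq3[OF _ E(1) J3[of E1 D E]]) simp
    moreover have "\<turnstile> E' \<^bold>\<longrightarrow> E1 \<^bold>\<or> E" if "E' \<in> Q" for E'
      by (rule conseq1[OF E(2)[rule_format, OF that]]) simp
    moreover have "\<turnstile> E1 \<^bold>\<longrightarrow> E1 \<^bold>\<or> E"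
      by (rule Taut) (simp add: tautology_def)
    ultimately show ?case by blast
  qed
  then show thesis using that by blast
qed

lemma Box_finite_conjunction:
  assumes "finite N" "\<And>B. B \<in> N \<Longrightarrow> \<turnstile> Y \<^bold>\<longrightarrow> \<^bold>\<box> B"
  obtains G where "\<turnstile> Y \<^bold>\<longrightarrow> \<^bold>\<box> G" "\<And>B. B \<in> N \<Longrightarrow> \<turnstile> G \<^bold>\<longrightarrow> B"
proof -
  have "\<exists>G. \<turnstile> Y \<^bold>\<longrightarrow> \<^bold>\<box> G \<and> (\<forall>B\<in>N. \<turnstile> G \<^bold>\<longrightarrow> B)"
    using assms
  proof (induction N rule: finite_induct)
    case empty
    have "\<turnstile> \<^bold>\<box> (\<^bold>\<not> \<^bold>\<bottom>)"
      by (rule Nec, rule Taut) (simp add: tautology_def)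
    then have "\<turnstile> Y \<^bold>\<longrightarrow> \<^bold>\<box> (\<^bold>\<not> \<^bold>\<bottom>)"
      by (rule conseq1) simp
    then show ?case by blast
  next
    case (insert B1 N)
    then obtain G where G: "\<turnstile> Y \<^bold>\<longrightarrow> \<^bold>\<box> G" "\<forall>B\<in>N. \<turnstile> G \<^bold>\<longrightarrow> B" by auto
    have "\<turnstile> Y \<^bold>\<longrightarrow> \<^bold>\<box> B1" using insert.prems by simp
    then have "\<turnstile> Y \<^bold>\<longrightarrow> \<^bold>\<box> (B1 \<^bold>\<and> G)"
      by (rule conseq3[OF _ G(1) Box_And[of B1 G]]) simp
    moreover have "\<turnstile> B1 \<^bold>\<and> G \<^bold>\<longrightarrow> B" if "B \<in> N" for B
      by (rule conseq1[OF G(2)[rule_format, OF that]]) simp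
    moreover have "\<turnstile> B1 \<^bold>\<and> G \<^bold>\<longrightarrow> B1"
      by (rule Taut) (simp add: tautology_def)
    ultimately show ?case by blast
  qed
  then show thesis using that by blast
qed


section \<open>Consistent formulas and critical successors\<close>

definition consistent :: "fm \<Rightarrow> bool" where
  "consistent Y \<longleftrightarrow> \<not> \<turnstile> \<^bold>\<not> Y"

lemma consistent_not_both:
  assumes "consistent Y" "\<turnstile> Y \<^bold>\<longrightarrow> B"
  shows "\<not> \<turnstile> Y \<^bold>\<longrightarrow> \<^bold>\<not> B"
proof
  assume "\<turnstile> Y \<^bold>\<longrightarrow> \<^bold>\<not> B"
  then have "\<turnstile> \<^bold>\<not> Y" by (rule conseq2[OF assms(2)]) simp
  then show False using assms(1) by (simp add: consistent_def)
qed

text \<open>Since only finitely many formulas have to be decided, a single formula can play the role of a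
  maximal consistent set.\<close>

lemma finite_Lindenbaum:
  assumes "finite \<Phi>" "consistent X"
  obtains Y where "consistent Y" "\<turnstile> Y \<^bold>\<longrightarrow> X"
    "\<And>B. B \<in> \<Phi> \<Longrightarrow> \<turnstile> Y \<^bold>\<longrightarrow> B \<or> \<turnstile> Y \<^bold>\<longrightarrow> \<^bold>\<not> B"
proof -
  have "\<exists>Y. consistent Y \<and> \<turnstile> Y \<^bold>\<longrightarrow> X \<and> (\<forall>B\<in>\<Phi>. \<turnstile> Y \<^bold>\<longrightarrow> B \<or> \<turnstile> Y \<^bold>\<longrightarrow> \<^bold>\<not> B)"
    using assms(1)
  proof (induction \<Phi> rule: finite_induct)
    case empty
    have "\<turnstile> X \<^bold>\<longrightarrow> X" by (rule Taut) (simp add: tautology_def)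
    with assms(2) show ?case by blast
  next
    case (insert C \<Phi>)
    then obtain Y where Y: "consistent Y" "\<turnstile> Y \<^bold>\<longrightarrow> X"
      "\<forall>B\<in>\<Phi>. \<turnstile> Y \<^bold>\<longrightarrow> B \<or> \<turnstile> Y \<^bold>\<longrightarrow> \<^bold>\<not> B" by blast
    have "consistent (Y \<^bold>\<and> C) \<or> consistent (Y \<^bold>\<and> \<^bold>\<not> C)"
    proof (rule ccontr)
      assume "\<not> ?thesis"
      then have "\<turnstile> \<^bold>\<not> (Y \<^bold>\<and> C)" "\<turnstile> \<^bold>\<not> (Y \<^bold>\<and> \<^bold>\<not> C)" by (auto simp: consistent_def)
      then have "\<turnstile> \<^bold>\<not> Y" by (rule conseq2) auto
      then show False using Y(1) by (simp add: consistent_def)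
    qed
    then obtain L where L: "L = C \<or> L = \<^bold>\<not> C" "consistent (Y \<^bold>\<and> L)" by blast
    have weaken: "\<turnstile> Y \<^bold>\<and> L \<^bold>\<longrightarrow> B" if "\<turnstile> Y \<^bold>\<longrightarrow> B" for B
      by (rule conseq1[OF that]) simp
    have "\<turnstile> Y \<^bold>\<and> L \<^bold>\<longrightarrow> L" by (rule Taut) (simp add: tautology_def)
    then show ?case using L Y weaken by blast
  qed
  then show thesis using that by blast
qed

definition modal :: "fm \<Rightarrow> bool" where
  "modal B \<longleftrightarrow> (\<exists>C. B = \<^bold>\<box> C) \<or> (\<exists>C D. B = C \<rhd> D)"

lemma modal_simps [simp]: "modal (\<^bold>\<box> C)" "modal (C \<rhd> D)"
  by (simp_all add: modal_def)

lemma modal_persistent: "modal B \<Longrightarrow> \<turnstile> B \<^bold>\<longrightarrow> \<^bold>\<box> B"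
  by (auto simp: modal_def intro: Box_trans P)

text \<open>If \<open>Y\<close> refutes \<open>C \<rhd> D\<close>, then \<open>Y\<close> is compatible with a successor that satisfies \<open>C\<close> although it
  avoids all the \<open>E\<close> for which \<open>Y\<close> proves \<open>E \<rhd> D\<close>.  Loeb's axiom supplies a last such
  successor \<open>Z\<close>, where \<open>C \<rhd> D\<close> has become true.\<close>

lemma critical_successor:
  assumes Y: "consistent Y" "\<turnstile> Y \<^bold>\<longrightarrow> \<^bold>\<not> (C \<rhd> D)"
    and M: "finite M" "\<And>B. B \<in> M \<Longrightarrow> modal B" "\<And>B. B \<in> M \<Longrightarrow> \<turnstile> Y \<^bold>\<longrightarrow> B"
    and Q: "finite Q" "\<And>E. E \<in> Q \<Longrightarrow> \<turnstile> Y \<^bold>\<longrightarrow> E \<rhd> D"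
  obtains Z where "consistent Z" "\<turnstile> Z \<^bold>\<longrightarrow> C" "\<turnstile> Z \<^bold>\<longrightarrow> C \<rhd> D"
    "\<And>B. B \<in> M \<Longrightarrow> \<turnstile> Z \<^bold>\<longrightarrow> B" "\<And>B. \<^bold>\<box> B \<in> M \<Longrightarrow> \<turnstile> Z \<^bold>\<longrightarrow> B"
    "\<And>E. E \<in> Q \<Longrightarrow> \<turnstile> Z \<^bold>\<longrightarrow> \<^bold>\<not> E"
proof -
  obtain E where E: "\<turnstile> Y \<^bold>\<longrightarrow> E \<rhd> D" "\<And>E'. E' \<in> Q \<Longrightarrow> \<turnstile> E' \<^bold>\<longrightarrow> E"
    using Rhd_finite_disjunction[OF Q] by blast
  define N where "N = insert (E \<rhd> D) (M \<union> {B. \<^bold>\<box> B \<in> M})"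
  have "finite (Box -` M)"
    by (rule finite_vimageI[OF M(1)]) (simp add: inj_on_def)
  moreover have "{B. \<^bold>\<box> B \<in> M} = Box -` M" by auto
  ultimately have "finite N" using M(1) by (simp add: N_def)
  moreover have "\<turnstile> Y \<^bold>\<longrightarrow> \<^bold>\<box> B" if B: "B \<in> N" for B
  proof (cases "\<^bold>\<box> B \<in> M")
    case True
    then show ?thesis by (rule M(3))
  next
    case False
    then have "modal B" "\<turnstile> Y \<^bold>\<longrightarrow> B" using B E(1) M by (auto simp: N_def)
    then show ?thesis using modal_persistent imp_trans by blast
  qed
  ultimately obtain G where G: "\<turnstile> Y \<^bold>\<longrightarrow> \<^bold>\<box> G" "\<And>B. B \<in> N \<Longrightarrow> \<turnstile> G \<^bold>\<longrightarrow> B"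
    using Box_finite_conjunction by blast
  define X where "X = C \<^bold>\<and> \<^bold>\<not> E"
  define Z where "Z = X \<^bold>\<and> (\<^bold>\<box> (\<^bold>\<not> X) \<^bold>\<and> G)"
  have collapse: "\<turnstile> \<^bold>\<box> (\<^bold>\<not> X) \<^bold>\<and> (E \<rhd> D) \<^bold>\<longrightarrow> C \<rhd> D"
    unfolding X_def by (rule Rhd_by_Box)
  have "consistent Z"
  proof (rule ccontr)
    assume "\<not> consistent Z"
    then have "\<turnstile> \<^bold>\<not> Z" by (simp add: consistent_def)
    then have "\<turnstile> G \<^bold>\<longrightarrow> (\<^bold>\<box> (\<^bold>\<not> X) \<^bold>\<longrightarrow> \<^bold>\<not> X)"
      by (rule conseq1) (auto simp: Z_def)
    then have "\<turnstile> Y \<^bold>\<longrightarrow> \<^bold>\<box> (\<^bold>\<not> X)"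
      using imp_trans[OF G(1)] Box_mono Loeb imp_trans by blast
    then have "\<turnstile> Y \<^bold>\<longrightarrow> C \<rhd> D"
      by (rule conseq3[OF _ E(1) collapse]) simp
    then show False using consistent_not_both[OF Y(1)] Y(2) by blast
  qed
  moreover have from_G: "\<turnstile> Z \<^bold>\<longrightarrow> B" if "B \<in> N" for B
    by (rule conseq1[OF G(2)[OF that]]) (simp add: Z_def)
  moreover have "\<turnstile> Z \<^bold>\<longrightarrow> C"
    by (rule Taut) (simp add: tautology_def Z_def X_def)
  moreover have "\<turnstile> Z \<^bold>\<longrightarrow> C \<rhd> D"
  proof (rule conseq2[OF collapse])
    show "\<turnstile> Z \<^bold>\<longrightarrow> E \<rhd> D" by (rule from_G) (simp add: N_def)
  qed (simp add: Z_def)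
  moreover have "\<turnstile> Z \<^bold>\<longrightarrow> \<^bold>\<not> E'" if "E' \<in> Q" for E'
    by (rule conseq1[OF E(2)[OF that]]) (auto simp: Z_def X_def)
  ultimately show thesis
    by (intro that) (auto simp: N_def)
qed


section \<open>Atoms\<close>

primrec subformulas :: "fm \<Rightarrow> fm set" where
  "subformulas (Var p) = {Var p}"
| "subformulas \<^bold>\<bottom> = {\<^bold>\<bottom>}"
| "subformulas (\<^bold>\<not> A) = insert (\<^bold>\<not> A) (subformulas A)"
| "subformulas (A \<^bold>\<and> B) = insert (A \<^bold>\<and> B) (subformulas A \<union> subformulas B)"
| "subformulas (A \<^bold>\<or> B) = insert (A \<^bold>\<or> B) (subformulas A \<union> subformulas B)"
| "subformulas (A \<^bold>\<longrightarrow> B) = insert (A \<^bold>\<longrightarrow> B) (subformulas A \<union> subformulas B)"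
| "subformulas (\<^bold>\<box> A) = insert (\<^bold>\<box> A) (subformulas A)"
| "subformulas (A \<rhd> B) = insert (A \<rhd> B) (subformulas A \<union> subformulas B)"

lemma finite_subformulas [simp]: "finite (subformulas A)"
  by (induction A) auto

lemma subformulas_refl [simp]: "A \<in> subformulas A"
  by (cases A) auto

lemma subformulas_trans: "B \<in> subformulas A \<Longrightarrow> subformulas B \<subseteq> subformulas A"
  by (induction A) auto

text \<open>\<open>Y\<close> stands in for a maximal consistent set.  Only its trace \<open>\<Gamma>\<close> on \<open>\<Phi>\<close> is kept in a world: there
  are finitely many traces, but infinitely many formulas \<open>Y\<close> with the same trace.\<close>

definition describes :: "fm set \<Rightarrow> fm \<Rightarrow> fm set \<Rightarrow> bool" where
  "describes \<Phi> Y \<Gamma> \<longleftrightarrow> consistent Y \<and> \<Gamma> \<subseteq> \<Phi> \<and>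
     (\<forall>B\<in>\<Phi>. if B \<in> \<Gamma> then \<turnstile> Y \<^bold>\<longrightarrow> B else \<turnstile> Y \<^bold>\<longrightarrow> \<^bold>\<not> B)"

definition atom :: "fm set \<Rightarrow> fm set \<Rightarrow> bool" where
  "atom \<Phi> \<Gamma> \<longleftrightarrow> (\<exists>Y. describes \<Phi> Y \<Gamma>)"

lemma describes_iff:
  assumes "describes \<Phi> Y \<Gamma>"
  shows "B \<in> \<Gamma> \<longleftrightarrow> B \<in> \<Phi> \<and> \<turnstile> Y \<^bold>\<longrightarrow> B"
  using assms consistent_not_both unfolding describes_def by (metis subsetD)

lemma describes_refuted:
  "describes \<Phi> Y \<Gamma> \<Longrightarrow> B \<in> \<Phi> \<Longrightarrow> B \<notin> \<Gamma> \<Longrightarrow> \<turnstile> Y \<^bold>\<longrightarrow> \<^bold>\<not> B"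
  by (auto simp: describes_def split: if_splits)

lemma describes_notin:
  assumes "describes \<Phi> Y \<Gamma>" "\<turnstile> Y \<^bold>\<longrightarrow> \<^bold>\<not> B"
  shows "B \<notin> \<Gamma>"
  using assms consistent_not_both describes_iff unfolding describes_def by blast

lemma atom_extending:
  assumes "finite \<Phi>" "consistent X"
  obtains Y \<Gamma> where "describes \<Phi> Y \<Gamma>" "\<turnstile> Y \<^bold>\<longrightarrow> X"
proof -
  obtain Y where Y: "consistent Y" "\<turnstile> Y \<^bold>\<longrightarrow> X"
    "\<And>B. B \<in> \<Phi> \<Longrightarrow> \<turnstile> Y \<^bold>\<longrightarrow> B \<or> \<turnstile> Y \<^bold>\<longrightarrow> \<^bold>\<not> B"
    using finite_Lindenbaum[OF assms] by blast
  then have "describes \<Phi> Y {B \<in> \<Phi>. \<turnstile> Y \<^bold>\<longrightarrow> B}"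
    by (auto simp: describes_def)
  then show thesis using that Y(2) by blast
qed

lemma atom_separating:
  assumes "finite \<Phi>" "F \<in> \<Phi>" "\<not> \<turnstile> F \<^bold>\<longrightarrow> D"
  obtains \<Gamma> where "atom \<Phi> \<Gamma>" "F \<in> \<Gamma>" "D \<notin> \<Gamma>"
proof -
  have "consistent (F \<^bold>\<and> \<^bold>\<not> D)"
    unfolding consistent_def
  proof
    assume "\<turnstile> \<^bold>\<not> (F \<^bold>\<and> \<^bold>\<not> D)"
    then have "\<turnstile> F \<^bold>\<longrightarrow> D" by (rule conseq1) simp
    with assms(3) show False ..
  qed
  then obtain Y \<Gamma> where Y: "describes \<Phi> Y \<Gamma>" "\<turnstile> Y \<^bold>\<longrightarrow> F \<^bold>\<and> \<^bold>\<not> D"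
    using atom_extending[OF assms(1)] by blast
  have "\<turnstile> Y \<^bold>\<longrightarrow> F" "\<turnstile> Y \<^bold>\<longrightarrow> \<^bold>\<not> D"
    by (rule conseq1[OF Y(2)], simp)+
  then show thesis
    using that[of \<Gamma>] Y(1) assms(2) describes_iff describes_notin unfolding atom_def by blast
qed

lemma atom_Bot: "atom \<Phi> \<Gamma> \<Longrightarrow> \<^bold>\<bottom> \<notin> \<Gamma>"
proof -
  assume "atom \<Phi> \<Gamma>"
  then obtain Y where Y: "describes \<Phi> Y \<Gamma>" by (auto simp: atom_def)
  have "\<turnstile> Y \<^bold>\<longrightarrow> \<^bold>\<not> \<^bold>\<bottom>" by (rule Taut) (simp add: tautology_def)
  with Y show ?thesis by (rule describes_notin)
qed

text \<open>Membership in an atom respects the connectives, because the deciding formula proves exactly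
  one of \<open>B\<close> and \<open>\<not> B\<close>.\<close>

lemma atom_Neg:
  assumes "atom \<Phi> \<Gamma>" "\<^bold>\<not> B \<in> \<Phi>" "B \<in> \<Phi>"
  shows "\<^bold>\<not> B \<in> \<Gamma> \<longleftrightarrow> B \<notin> \<Gamma>"
  using assms describes_iff describes_refuted describes_notin unfolding atom_def by metis

lemma atom_closed:
  assumes "atom \<Phi> \<Gamma>" "C \<in> \<Phi>" "A \<in> \<Phi>" "B \<in> \<Phi>"
    and "\<And>v. bool_eval v C \<longleftrightarrow> f (bool_eval v A) (bool_eval v B)"
  shows "C \<in> \<Gamma> \<longleftrightarrow> f (A \<in> \<Gamma>) (B \<in> \<Gamma>)"
proof -
  obtain Y where Y: "describes \<Phi> Y \<Gamma>" using assms(1) by (auto simp: atom_def)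
  define lit where "lit X = (if X \<in> \<Gamma> then X else \<^bold>\<not> X)" for X
  have lit: "\<turnstile> Y \<^bold>\<longrightarrow> lit X" if "X \<in> \<Phi>" for X
    using Y that by (auto simp: lit_def describes_iff describes_refuted)
  have eval_lit: "bool_eval v (lit X) \<longleftrightarrow> (bool_eval v X \<longleftrightarrow> X \<in> \<Gamma>)" for v X
    by (simp add: lit_def)
  show ?thesis
  proof (rule ccontr)
    assume "\<not> ?thesis"
    then have "\<turnstile> \<^bold>\<not> Y"
      by (intro conseq3[OF lit[OF assms(2)] lit[OF assms(3)] lit[OF assms(4)]])
        (auto simp: eval_lit assms(5))
    then show False using Y by (simp add: describes_def consistent_def)
  qed
qed

text \<open>The relation between an atom and its \<open>R\<close>-successors with tag \<open>Some D\<close>.  The inclusion of modal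
  parts makes it transitive, and its strictness makes it irreflexive; the last conjunct keeps the
  obligations \<open>E \<rhd> F \<in> \<Gamma>\<close> away from successors whose tag rules out every witness of \<open>F\<close>.\<close>

definition critical :: "fm \<Rightarrow> fm set \<Rightarrow> fm set \<Rightarrow> bool" where
  "critical D \<Gamma> \<Delta> \<longleftrightarrow> Collect modal \<inter> \<Gamma> \<subset> Collect modal \<inter> \<Delta> \<and>
     (\<forall>B. \<^bold>\<box> B \<in> \<Gamma> \<longrightarrow> B \<in> \<Delta>) \<and> (\<forall>E F. E \<rhd> F \<in> \<Gamma> \<and> \<turnstile> F \<^bold>\<longrightarrow> D \<longrightarrow> E \<notin> \<Delta>)"

lemma critical_trans: "critical D \<Gamma> \<Delta> \<Longrightarrow> critical D' \<Delta> \<Theta> \<Longrightarrow> critical D' \<Gamma> \<Theta>"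
  unfolding critical_def using modal_simps by blast

lemma critical_irrefl: "\<not> critical D \<Gamma> \<Gamma>"
  by (simp add: critical_def)

text \<open>The hypothesis on \<open>B\<close> covers both modalities: \<open>B\<close> is \<open>C \<rhd> D\<close> itself, or \<open>\<box> C'\<close> with
  \<open>C = \<not> C'\<close> and \<open>D = \<bottom>\<close>.\<close>

lemma critical_exists:
  assumes \<Phi>: "finite \<Phi>" "\<And>B. B \<in> \<Phi> \<Longrightarrow> subformulas B \<subseteq> \<Phi>"
    and "atom \<Phi> \<Gamma>" and B: "modal B" "B \<in> \<Phi>" "B \<notin> \<Gamma>" "\<turnstile> B \<^bold>\<longleftrightarrow> (C \<rhd> D)"
  obtains Z \<Delta> where "describes \<Phi> Z \<Delta>" "\<turnstile> Z \<^bold>\<longrightarrow> C" "critical D \<Gamma> \<Delta>"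
proof -
  obtain Y where Y: "describes \<Phi> Y \<Gamma>" using assms(3) by (auto simp: atom_def)
  have "\<Gamma> \<subseteq> \<Phi>" using Y by (simp add: describes_def)
  have consistent: "consistent Y" using Y by (simp add: describes_def)
  have not_CD: "\<turnstile> Y \<^bold>\<longrightarrow> \<^bold>\<not> (C \<rhd> D)"
    by (rule conseq2[OF B(4) describes_refuted[OF Y B(2,3)]]) auto
  have finite_M: "finite (Collect modal \<inter> \<Gamma>)"
    using \<Phi>(1) \<open>\<Gamma> \<subseteq> \<Phi>\<close> finite_subset by blast
  have M: "\<turnstile> Y \<^bold>\<longrightarrow> B'" if "B' \<in> Collect modal \<inter> \<Gamma>" for B'
    using that describes_iff[OF Y] by blast
  define Q where "Q = {E. \<exists>F. E \<rhd> F \<in> \<Gamma> \<and> \<turnstile> F \<^bold>\<longrightarrow> D}"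
  have "Q \<subseteq> \<Phi>"
  proof
    fix E assume "E \<in> Q"
    then obtain F where "E \<rhd> F \<in> \<Phi>" using \<open>\<Gamma> \<subseteq> \<Phi>\<close> by (auto simp: Q_def)
    from \<Phi>(2)[OF this] show "E \<in> \<Phi>" by auto
  qed
  then have finite_Q: "finite Q" using \<Phi>(1) finite_subset by blast
  have Q: "\<turnstile> Y \<^bold>\<longrightarrow> E \<rhd> D" if "E \<in> Q" for E
    using that R1 imp_trans describes_iff[OF Y] unfolding Q_def by blast
  obtain X where X: "consistent X" "\<turnstile> X \<^bold>\<longrightarrow> C" "\<turnstile> X \<^bold>\<longrightarrow> C \<rhd> D"
    "\<And>B. B \<in> Collect modal \<inter> \<Gamma> \<Longrightarrow> \<turnstile> X \<^bold>\<longrightarrow> B"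
    "\<And>B. \<^bold>\<box> B \<in> Collect modal \<inter> \<Gamma> \<Longrightarrow> \<turnstile> X \<^bold>\<longrightarrow> B" "\<And>E. E \<in> Q \<Longrightarrow> \<turnstile> X \<^bold>\<longrightarrow> \<^bold>\<not> E"
    by (rule critical_successor[OF consistent not_CD finite_M _ M finite_Q Q]) auto
  obtain Z \<Delta> where Z: "describes \<Phi> Z \<Delta>" "\<turnstile> Z \<^bold>\<longrightarrow> X"
    using atom_extending[OF \<Phi>(1) X(1)] by blast
  have in_\<Delta>: "B' \<in> \<Delta>" if "\<turnstile> X \<^bold>\<longrightarrow> B'" "B' \<in> \<Phi>" for B'
    using that Z imp_trans describes_iff by blast
  have "Collect modal \<inter> \<Gamma> \<subseteq> \<Delta>"
    using in_\<Delta> X(4) \<open>\<Gamma> \<subseteq> \<Phi>\<close> by blast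
  moreover have "\<turnstile> X \<^bold>\<longrightarrow> B"
    by (rule conseq2[OF B(4) X(3)]) auto
  then have "B \<in> \<Delta>" using in_\<Delta> B(2) by blast
  moreover have "B' \<in> \<Delta>" if "\<^bold>\<box> B' \<in> \<Gamma>" for B'
  proof (rule in_\<Delta>)
    show "\<turnstile> X \<^bold>\<longrightarrow> B'" using X(5) that by simp
    have "\<^bold>\<box> B' \<in> \<Phi>" using that \<open>\<Gamma> \<subseteq> \<Phi>\<close> by blast
    from \<Phi>(2)[OF this] show "B' \<in> \<Phi>" by auto
  qed
  moreover have "E \<notin> \<Delta>" if "E \<rhd> F \<in> \<Gamma>" "\<turnstile> F \<^bold>\<longrightarrow> D" for E F
  proof -
    have "E \<in> Q" using that by (auto simp: Q_def)
    then show ?thesis using describes_notin[OF Z(1)] imp_trans[OF Z(2) X(6)] by blast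
  qed
  ultimately have "critical D \<Gamma> \<Delta>"
    using B(1,3) unfolding critical_def by blast
  then show thesis using that Z(1) imp_trans[OF Z(2) X(2)] by blast
qed


section \<open>The countermodel\<close>

primrec eval :: "'w rel \<Rightarrow> 'w rel \<Rightarrow> ('w \<Rightarrow> nat \<Rightarrow> bool) \<Rightarrow> 'w \<Rightarrow> fm \<Rightarrow> bool" where
  "eval R S V w (Var p) = V w p"
| "eval R S V w \<^bold>\<bottom> = False"
| "eval R S V w (\<^bold>\<not> A) = (\<not> eval R S V w A)"
| "eval R S V w (A \<^bold>\<and> B) = (eval R S V w A \<and> eval R S V w B)"
| "eval R S V w (A \<^bold>\<or> B) = (eval R S V w A \<or> eval R S V w B)"
| "eval R S V w (A \<^bold>\<longrightarrow> B) = (eval R S V w A \<longrightarrow> eval R S V w B)"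
| "eval R S V w (\<^bold>\<box> A) = (\<forall>x. (w, x) \<in> R \<longrightarrow> eval R S V x A)"
| "eval R S V w (A \<rhd> B) =
    (\<forall>x. (w, x) \<in> R \<and> eval R S V x A \<longrightarrow> (\<exists>y. (x, y) \<in> S \<and> eval R S V y B))"

lemma eval_model:
  assumes "simplified_frame W R S"
  shows "simplified_model W R S (eval R S V)"
proof -
  interpret simplified_frame W R S by (rule assms)
  show ?thesis
    by unfold_locales (use R_on S_on in \<open>auto; blast\<close>)+
qed

definition worlds :: "fm set \<Rightarrow> (fm set \<times> fm option) set" where
  "worlds \<Phi> = Collect (atom \<Phi>) \<times> insert None (Some ` insert \<^bold>\<bottom> \<Phi>)"

definition accR :: "fm set \<Rightarrow> (fm set \<times> fm option) rel" where
  "accR \<Phi> = {((\<Gamma>, t), (\<Delta>, t')). (\<Gamma>, t) \<in> worlds \<Phi> \<and> (\<Delta>, t') \<in> worlds \<Phi> \<and>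
     (\<exists>D. t' = Some D \<and> critical D \<Gamma> \<Delta>)}"

definition accS :: "fm set \<Rightarrow> (fm set \<times> fm option) rel" where
  "accS \<Phi> = {((\<Delta>, t), (\<Theta>, t')). (\<Delta>, t) \<in> worlds \<Phi> \<and> (\<Theta>, t') \<in> worlds \<Phi> \<and>
     (\<exists>D. t = Some D \<and> t' = None \<and> D \<notin> \<Theta>)}"

lemma finite_worlds: "finite \<Phi> \<Longrightarrow> finite (worlds \<Phi>)"
proof -
  assume "finite \<Phi>"
  moreover have "Collect (atom \<Phi>) \<subseteq> Pow \<Phi>" by (auto simp: atom_def describes_def)
  ultimately show ?thesis by (auto simp: worlds_def intro: finite_subset)
qed

lemma accS_no_composition: "(x, y) \<in> accS \<Phi> \<Longrightarrow> (y, z) \<notin> accS \<Phi>"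
  by (auto simp: accS_def)

lemma frame_worlds:
  assumes "finite \<Phi>" "worlds \<Phi> \<noteq> {}"
  shows "simplified_frame (worlds \<Phi>) (accR \<Phi>) (accS \<Phi>)"
proof
  show R_on: "accR \<Phi> \<subseteq> worlds \<Phi> \<times> worlds \<Phi>" by (auto simp: accR_def)
  show trans: "trans (accR \<Phi>)"
    by (rule transI) (auto simp: accR_def intro: critical_trans)
  have "irrefl (accR \<Phi>)"
    by (auto simp: irrefl_def accR_def critical_irrefl)
  with trans have "acyclic (accR \<Phi>)"
    by (simp add: acyclic_irrefl)
  moreover have "finite (accR \<Phi>)"
    using R_on finite_worlds[OF assms(1)] by (meson finite_SigmaI finite_subset)
  ultimately show "wf ((accR \<Phi>)\<inverse>)"
    by (simp add: finite_acyclic_wf_converse)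
qed (use assms(2) in \<open>auto simp: accS_def\<close>)

lemma truth_lemma:
  assumes \<Phi>: "finite \<Phi>" "\<And>B. B \<in> \<Phi> \<Longrightarrow> subformulas B \<subseteq> \<Phi>"
    and "B \<in> \<Phi>" "(\<Gamma>, t) \<in> worlds \<Phi>"
  shows "eval (accR \<Phi>) (accS \<Phi>) (\<lambda>w p. Var p \<in> fst w) (\<Gamma>, t) B \<longleftrightarrow> B \<in> \<Gamma>"
    (is "?ev (\<Gamma>, t) B \<longleftrightarrow> _")
  using assms(3,4)
proof (induction B arbitrary: \<Gamma> t)
  case (Var p)
  then show ?case by simp
next
  case Bot
  then show ?case using atom_Bot by (auto simp: worlds_def)
next
  case (Neg A)
  have "A \<in> \<Phi>" using \<Phi>(2)[OF Neg.prems(1)] by auto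
  then show ?case
    using Neg.IH[of \<Gamma> t] Neg.prems atom_Neg[of \<Phi> \<Gamma> A] by (auto simp: worlds_def)
next
  case (And A B)
  have sub: "A \<in> \<Phi>" "B \<in> \<Phi>" using \<Phi>(2)[OF And.prems(1)] by auto
  have "atom \<Phi> \<Gamma>" using And.prems by (simp add: worlds_def)
  from atom_closed[OF this And.prems(1) sub, of "(\<and>)"]
  show ?case using And.IH[of \<Gamma> t] And.prems(2) sub by simp
next
  case (Or A B)
  have sub: "A \<in> \<Phi>" "B \<in> \<Phi>" using \<Phi>(2)[OF Or.prems(1)] by auto
  have "atom \<Phi> \<Gamma>" using Or.prems by (simp add: worlds_def)
  from atom_closed[OF this Or.prems(1) sub, of "(\<or>)"]
  show ?case using Or.IH[of \<Gamma> t] Or.prems(2) sub by simp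
next
  case (Imp A B)
  have sub: "A \<in> \<Phi>" "B \<in> \<Phi>" using \<Phi>(2)[OF Imp.prems(1)] by auto
  have "atom \<Phi> \<Gamma>" using Imp.prems by (simp add: worlds_def)
  from atom_closed[OF this Imp.prems(1) sub, of "(\<longrightarrow>)"]
  show ?case using Imp.IH[of \<Gamma> t] Imp.prems(2) sub by simp
next
  case (Box A)
  have A: "A \<in> \<Phi>" using \<Phi>(2)[OF Box.prems(1)] by auto
  have atom: "atom \<Phi> \<Gamma>" using Box.prems by (simp add: worlds_def)
  show ?case
  proof
    assume "\<^bold>\<box> A \<in> \<Gamma>"
    then have "A \<in> fst x" "x \<in> worlds \<Phi>" if "((\<Gamma>, t), x) \<in> accR \<Phi>" for x
      using that by (auto simp: accR_def critical_def)
    then show "?ev (\<Gamma>, t) (\<^bold>\<box> A)" using Box.IH[OF A] by force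
  next
    assume ev: "?ev (\<Gamma>, t) (\<^bold>\<box> A)"
    show "\<^bold>\<box> A \<in> \<Gamma>"
    proof (rule ccontr)
      assume "\<^bold>\<box> A \<notin> \<Gamma>"
      then obtain Z \<Delta> where Z: "describes \<Phi> Z \<Delta>" "\<turnstile> Z \<^bold>\<longrightarrow> \<^bold>\<not> A" "critical \<^bold>\<bottom> \<Gamma> \<Delta>"
        using critical_exists[OF \<Phi> atom modal_simps(1) Box.prems(1) _ J6] by blast
      then have x: "(\<Delta>, Some \<^bold>\<bottom>) \<in> worlds \<Phi>" by (auto simp: worlds_def atom_def)
      then have "((\<Gamma>, t), (\<Delta>, Some \<^bold>\<bottom>)) \<in> accR \<Phi>" using Box.prems Z(3) by (simp add: accR_def)
      then have "A \<in> \<Delta>" using ev Box.IH[OF A x] by simp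
      then show False using describes_notin[OF Z(1,2)] by simp
    qed
  qed
next
  case (Rhd C D)
  have sub: "C \<in> \<Phi>" "D \<in> \<Phi>" using \<Phi>(2)[OF Rhd.prems(1)] by auto
  have atom: "atom \<Phi> \<Gamma>" using Rhd.prems by (simp add: worlds_def)
  show ?case
  proof
    assume CD: "C \<rhd> D \<in> \<Gamma>"
    have "\<exists>y. (x, y) \<in> accS \<Phi> \<and> ?ev y D"
      if R: "((\<Gamma>, t), x) \<in> accR \<Phi>" and C: "?ev x C" for x
    proof -
      obtain \<Delta> G where x: "x = (\<Delta>, Some G)" "(\<Delta>, Some G) \<in> worlds \<Phi>" "critical G \<Gamma> \<Delta>"
        using R by (auto simp: accR_def)
      then have "C \<in> \<Delta>" using Rhd.IH(1)[OF sub(1)] C by simp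
      then have "\<not> \<turnstile> D \<^bold>\<longrightarrow> G" using x(3) CD by (auto simp: critical_def)
      then obtain \<Theta> where \<Theta>: "atom \<Phi> \<Theta>" "D \<in> \<Theta>" "G \<notin> \<Theta>"
        using atom_separating[OF \<Phi>(1) sub(2)] by blast
      then have y: "(\<Theta>, None) \<in> worlds \<Phi>" by (simp add: worlds_def)
      then have "(x, (\<Theta>, None)) \<in> accS \<Phi>" using x \<Theta>(3) by (simp add: accS_def)
      then show ?thesis using Rhd.IH(2)[OF sub(2) y] \<Theta>(2) by blast
    qed
    then show "?ev (\<Gamma>, t) (C \<rhd> D)" by simp
  next
    assume ev: "?ev (\<Gamma>, t) (C \<rhd> D)"
    show "C \<rhd> D \<in> \<Gamma>"
    proof (rule ccontr)
      have "\<turnstile> (C \<rhd> D) \<^bold>\<longleftrightarrow> (C \<rhd> D)" by (rule Taut) (simp add: tautology_def)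
      moreover assume "C \<rhd> D \<notin> \<Gamma>"
      ultimately obtain Z \<Delta> where Z: "describes \<Phi> Z \<Delta>" "\<turnstile> Z \<^bold>\<longrightarrow> C" "critical D \<Gamma> \<Delta>"
        using critical_exists[OF \<Phi> atom modal_simps(2) Rhd.prems(1)] by blast
      then have x: "(\<Delta>, Some D) \<in> worlds \<Phi>" using sub(2) by (auto simp: worlds_def atom_def)
      then have R: "((\<Gamma>, t), (\<Delta>, Some D)) \<in> accR \<Phi>" using Rhd.prems Z(3) by (simp add: accR_def)
      have "C \<in> \<Delta>" using describes_iff[OF Z(1)] sub(1) Z(2) by simp
      then have "?ev (\<Delta>, Some D) C" using Rhd.IH(1)[OF sub(1) x] by simp
      then obtain y where y: "((\<Delta>, Some D), y) \<in> accS \<Phi>" "?ev y D"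
        using ev R unfolding eval.simps by blast
      then obtain \<Theta> where "y = (\<Theta>, None)" "(\<Theta>, None) \<in> worlds \<Phi>" "D \<notin> \<Theta>"
        by (auto simp: accS_def)
      then show False using Rhd.IH(2)[OF sub(2)] y(2) by simp
    qed
  qed
qed


section \<open>Completeness over an arbitrary infinite type\<close>

text \<open>Along a surjection \<open>g\<close> the pulled-back relations relate two worlds precisely when their images
  are related, so quantification over successors is unaffected.  This moves the countermodel
  into the given type.\<close>

lemma model_pullback:
  assumes "simplified_model W R S forces" and g: "g ` W' = W"
  shows "simplified_model W' (inv_image R g \<inter> W' \<times> W') (inv_image S g \<inter> W' \<times> W')
    (\<lambda>w. forces (g w))"
proof -
  interpret simplified_model W R S forces by (rule assms)
  have gW: "g w \<in> W" if "w \<in> W'" for w using that g by auto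
  have all: "(\<forall>x\<in>W. Q x) \<longleftrightarrow> (\<forall>x\<in>W'. Q (g x))" and ex: "(\<exists>x\<in>W. Q x) \<longleftrightarrow> (\<exists>x\<in>W'. Q (g x))" for Q
    unfolding g[symmetric] by auto
  show ?thesis
  proof
    show "W' \<noteq> {}" using g nonempty by auto
    show "trans (inv_image R g \<inter> W' \<times> W')"
      using R_trans by (auto simp: trans_def inv_image_def)
    show "wf ((inv_image R g \<inter> W' \<times> W')\<inverse>)"
      by (rule wf_subset[OF wf_inv_image[OF R_conv_wf, of g]]) (auto simp: inv_image_def)
  qed (auto simp: gW forces_Bot forces_Neg forces_And forces_Or forces_Imp forces_Box forces_Rhd
      all ex inv_image_def)
qed

lemma provable_if_valid_finite:
  assumes inf: "infinite (UNIV :: 'v set)" and valid: "valid_finite_frames TYPE('v) A"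
  shows "\<turnstile> A"
proof (rule ccontr)
  assume "\<not> \<turnstile> A"
  define \<Phi> where "\<Phi> = subformulas A"
  have \<Phi>: "finite \<Phi>" "\<And>B. B \<in> \<Phi> \<Longrightarrow> subformulas B \<subseteq> \<Phi>" "A \<in> \<Phi>"
    using subformulas_trans by (auto simp: \<Phi>_def)
  have "consistent (\<^bold>\<not> A)"
    unfolding consistent_def
  proof
    assume "\<turnstile> \<^bold>\<not> \<^bold>\<not> A"
    then have "\<turnstile> A" by (rule conseq1) simp
    with \<open>\<not> \<turnstile> A\<close> show False ..
  qed
  then obtain Y \<Gamma> where "describes \<Phi> Y \<Gamma>" "\<turnstile> Y \<^bold>\<longrightarrow> \<^bold>\<not> A"
    using atom_extending[OF \<Phi>(1)] by blast
  then have \<Gamma>: "(\<Gamma>, None) \<in> worlds \<Phi>" "A \<notin> \<Gamma>"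
    using describes_notin by (auto simp: worlds_def atom_def)
  let ?ev = "eval (accR \<Phi>) (accS \<Phi>) (\<lambda>w p. Var p \<in> fst w)"
  have model: "simplified_model (worlds \<Phi>) (accR \<Phi>) (accS \<Phi>) ?ev"
    using \<Phi>(1) \<Gamma>(1) by (intro eval_model frame_worlds) auto
  have refuted: "\<not> ?ev (\<Gamma>, None) A"
    using truth_lemma[OF \<Phi> \<Gamma>(1)] \<Gamma>(2) by simp
  obtain W' :: "'v set" where W': "finite W'" "card W' = card (worlds \<Phi>)"
    using infinite_arbitrarily_large[OF inf] by blast
  then obtain g where "bij_betw g W' (worlds \<Phi>)"
    using finite_same_card_bij[OF W'(1) finite_worlds[OF \<Phi>(1)]] by blast
  then have g: "g ` W' = worlds \<Phi>" by (simp add: bij_betw_def)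
  let ?R = "inv_image (accR \<Phi>) g \<inter> W' \<times> W'"
  let ?S = "inv_image (accS \<Phi>) g \<inter> W' \<times> W'"
  have model': "simplified_model W' ?R ?S (\<lambda>w. ?ev (g w))"
    by (rule model_pullback[OF model g])
  moreover have "\<not> (\<exists>x\<in>W'. \<exists>y\<in>W'. \<exists>z\<in>W'. (x, y) \<in> ?S \<and> (y, z) \<in> ?S)"
    using accS_no_composition by (fastforce simp: inv_image_def)
  ultimately have "valid_in W' ?R ?S A"
    using valid W'(1) simplified_model.axioms(1)[OF model'] unfolding valid_finite_frames_def by blast
  with model' have "\<forall>w\<in>W'. ?ev (g w) A" unfolding valid_in_def by blast
  moreover obtain w where "w \<in> W'" "g w = (\<Gamma>, None)" using g \<Gamma>(1) by (metis imageE)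
  ultimately show False using refuted by metis
qed

text \<open>Validity in all frames of a type implies validity in its finite frames of the special kind, so
  each half of the equivalence needs completeness for its own type only, and no frame has to
  be moved between the two types.\<close>

theorem theorem4p12:
  fixes A :: fm
  assumes "infinite (UNIV :: 'u set)" and "infinite (UNIV :: 'v set)"
  shows "(\<turnstile> A \<longleftrightarrow> valid_all_frames TYPE('u) A) \<and>
         (valid_all_frames TYPE('u) A \<longleftrightarrow> valid_finite_frames TYPE('v) A)"
proof -
  have "valid_all_frames TYPE('u) A" "valid_finite_frames TYPE('v) A" if "\<turnstile> A"
    by (simp_all add: valid_all_frames_def valid_finite_frames_def valid_if_provable[OF that])
  moreover have "valid_finite_frames TYPE('u) A" if "valid_all_frames TYPE('u) A"
    using that by (simp add: valid_all_frames_def valid_finite_frames_def)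
  ultimately show ?thesis
    using provable_if_valid_finite[OF assms(1)] provable_if_valid_finite[OF assms(2)] by blast
qed

end
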